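(* An acyclic directed graph is admissible (in dimension $d$) if and only if it is persistent (in dimension $d$).
   Context: Fix $d\ge1$. Directed graphs are orientations of finite simple graphs; acyclic means without directed cycles. For a graph with vertex set $\{1,\dots,n\}$ and edge set $\mathcal E$, a configuration is $p=(p_1,\dots,p_n)\in\mathbb R^{dn}$; the distance map is $F(p)=(\|p_j-p_i\|^2)_{ij\in\mathcal E}$; the rigidity matrix $R(p)\in\mathbb R^{|\mathcal E|\times dn}$ has, in the row of edge $ij$, the block $(p_i-p_j)^\top$ at vertex $i$, $(p_j-p_i)^\top$ at vertex $j$, and zeros elsewhere. The graph is (generically) $d$-rigid if for generic $p$ every $q$ sufficiently close to $p$ with $F(q)=F(p)$ is congruent to $p$. Given an orientation, $\overrightarrow R(p)$ is obtained from $R(p)$ by keeping, in the row of $\overrightarrow{ij}$ (tail $i$, head $j$), only the block at the tail $i$. The edge operator is $Z(p)=2R(p)\overrightarrow R(p)^\top$; its image lies in $\operatorname{im}R(p)$. "For every generic $p$" means for all $p$ outside some proper algebraic subset of $\mathbb R^{dn}$ defined over $\mathbb Q$. A directed graph is admissible if its underlying graph is $d$-rigid and, for every generic $p$, $Z(p)|_{\operatorname{im}R(p)}$ is invertible. A directed graph is persistent (in dimension $d$) if every subgraph obtained from it by deleting out-going edges at vertices of out-degree larger than $d$, one at a time, until all out-degrees are at most $d$, has a $d$-rigid underlying graph. *)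

theory Defs
  imports "HOL-Analysis.Analysis" "HOL-Library.Poly_Mapping"
begin

text \<open>
  The vertex set is a finite type \<open>'v\<close> and the dimension is \<open>d = CARD('d)\<close>, so that \<open>d \<ge> 1\<close> holds
  automatically. The argument of type \<open>'d itself\<close> below names the dimension where it does not occur
  in any other argument.
\<close>

type_synonym ('d, 'v) configuration = "real ^ 'd ^ 'v"

text \<open>
  An arc \<open>(i, j)\<close> has tail \<open>i\<close> and head \<open>j\<close>. Asymmetry excludes both loops and pairs of opposite
  arcs, so these relations are exactly the orientations of simple graphs.
\<close>

definition directed_graph :: "('v::finite \<times> 'v) set \<Rightarrow> bool" where
  "directed_graph E \<longleftrightarrow> asym E"

text \<open>A simple graph is represented by its symmetric adjacency relation.\<close>

definition underlying_graph :: "('v::finite \<times> 'v) set \<Rightarrow> ('v \<times> 'v) set" where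
  "underlying_graph E = E \<union> E\<inverse>"

definition out_degree :: "('v::finite \<times> 'v) set \<Rightarrow> 'v \<Rightarrow> nat" where
  "out_degree E i = card {j. (i, j) \<in> E}"


text \<open>Polynomials over \<open>\<rat>\<close> in the coordinates of a configuration: the variable \<open>(i, k)\<close> stands for
  the \<open>k\<close>-th coordinate of \<open>p\<^sub>i\<close>.\<close>

definition eval_rat_poly ::
  "((('v::finite \<times> 'd::finite) \<Rightarrow>\<^sub>0 nat) \<Rightarrow>\<^sub>0 rat) \<Rightarrow> ('d, 'v) configuration \<Rightarrow> real" where
  "eval_rat_poly f p =
    (\<Sum>m\<in>Poly_Mapping.keys f. of_rat (Poly_Mapping.lookup f m) *
       (\<Prod>i\<in>UNIV. \<Prod>k\<in>UNIV. (p $ i $ k) ^ Poly_Mapping.lookup m (i, k)))"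

definition algebraic_over_rat :: "('d::finite, 'v::finite) configuration set \<Rightarrow> bool" where
  "algebraic_over_rat A \<longleftrightarrow>
    (\<exists>S :: ((('v \<times> 'd) \<Rightarrow>\<^sub>0 nat) \<Rightarrow>\<^sub>0 rat) set. A = {p. \<forall>f\<in>S. eval_rat_poly f p = 0})"

definition for_every_generic :: "(('d::finite, 'v::finite) configuration \<Rightarrow> bool) \<Rightarrow> bool" where
  "for_every_generic P \<longleftrightarrow>
    (\<exists>A. algebraic_over_rat A \<and> A \<noteq> UNIV \<and> (\<forall>p. p \<notin> A \<longrightarrow> P p))"


definition congruent_config ::
  "('d::finite, 'v::finite) configuration \<Rightarrow> ('d, 'v) configuration \<Rightarrow> bool" where
  "congruent_config p q \<longleftrightarrow> (\<forall>i j. norm (q $ j - q $ i) = norm (p $ j - p $ i))"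

text \<open>
  Vectors and matrices indexed by the edges are padded with zeros to all pairs of vertices, because
  the edge set is not a type: \<open>\<real>\<^sup>E\<close> becomes the subspace of the vectors in \<open>real ^ ('v \<times> 'v)\<close>
  that are supported on \<open>E\<close>. In the distance map of a symmetric adjacency relation every edge
  contributes two equal coordinates.
\<close>

definition distance_map ::
  "('v::finite \<times> 'v) set \<Rightarrow> ('d::finite, 'v) configuration \<Rightarrow> real ^ ('v \<times> 'v)" where
  "distance_map G p =
    (\<chi> e. case e of (i, j) \<Rightarrow> if (i, j) \<in> G then (norm (p $ j - p $ i))\<^sup>2 else 0)"

definition rigid :: "'d::finite itself \<Rightarrow> ('v::finite \<times> 'v) set \<Rightarrow> bool" where
  "rigid TYPE('d) G \<longleftrightarrow>
    for_every_generic (\<lambda>p :: ('d, 'v) configuration.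
      \<forall>\<^sub>F q in nhds p. distance_map G q = distance_map G p \<longrightarrow> congruent_config p q)"


definition rigidity_matrix ::
  "('v::finite \<times> 'v) set \<Rightarrow> ('d::finite, 'v) configuration \<Rightarrow> real ^ ('v \<times> 'd) ^ ('v \<times> 'v)" where
  "rigidity_matrix E p =
    (\<chi> e c. case (e, c) of ((i, j), (v, k)) \<Rightarrow>
       if (i, j) \<in> E
       then (if v = i then (p $ i - p $ j) $ k
             else if v = j then (p $ j - p $ i) $ k
             else 0)
       else 0)"

definition directed_rigidity_matrix ::
  "('v::finite \<times> 'v) set \<Rightarrow> ('d::finite, 'v) configuration \<Rightarrow> real ^ ('v \<times> 'd) ^ ('v \<times> 'v)" where
  "directed_rigidity_matrix E p =
    (\<chi> e c. case (e, c) of ((i, j), (v, k)) \<Rightarrow>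
       if (i, j) \<in> E \<and> v = i then (p $ i - p $ j) $ k else 0)"

definition edge_operator ::
  "('v::finite \<times> 'v) set \<Rightarrow> ('d::finite, 'v) configuration \<Rightarrow> real ^ ('v \<times> 'v) ^ ('v \<times> 'v)" where
  "edge_operator E p = 2 *\<^sub>R (rigidity_matrix E p ** transpose (directed_rigidity_matrix E p))"

definition admissible :: "'d::finite itself \<Rightarrow> ('v::finite \<times> 'v) set \<Rightarrow> bool" where
  "admissible TYPE('d) E \<longleftrightarrow>
    rigid TYPE('d) (underlying_graph E) \<and>
    for_every_generic (\<lambda>p :: ('d, 'v) configuration.
      bij_betw (\<lambda>y. edge_operator E p *v y)
        (range (\<lambda>x. rigidity_matrix E p *v x)) (range (\<lambda>x. rigidity_matrix E p *v x)))"


definition deletion_step :: "nat \<Rightarrow> ('v::finite \<times> 'v) set \<Rightarrow> ('v \<times> 'v) set \<Rightarrow> bool" where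
  "deletion_step d E E' \<longleftrightarrow> (\<exists>i j. (i, j) \<in> E \<and> out_degree E i > d \<and> E' = E - {(i, j)})"

definition persistent :: "'d::finite itself \<Rightarrow> ('v::finite \<times> 'v) set \<Rightarrow> bool" where
  "persistent TYPE('d) E \<longleftrightarrow>
    (\<forall>E'. (deletion_step CARD('d))\<^sup>*\<^sup>* E E' \<and> (\<forall>i. out_degree E' i \<le> CARD('d)) \<longrightarrow>
      rigid TYPE('d) (underlying_graph E'))"

end

theory Submission
  imports Defs "HOL-Computational_Algebra.Polynomial"
begin

text \<open>
  Write \<open>R\<close> for the rigidity matrix at a generic configuration and \<open>L\<close> for the product of the
  transposed directed rigidity matrix with \<open>R\<close>, so that the edge operator satisfies \<open>Z R = 2 R L\<close>.
  Then \<open>Z\<close> is invertible on the image of \<open>R\<close> if and only if \<open>L\<close> is injective modulo \<open>ker R\<close>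
  (\<open>bij_edge_operator_iff\<close>). Since the graph is acyclic, its vertices can be ordered such that \<open>L\<close>
  is block triangular. The diagonal block of vertex \<open>i\<close> is the sum of the squares
  \<open>(p\<^sub>i - p\<^sub>j) (p\<^sub>i - p\<^sub>j)\<^sup>T\<close> over the arcs from \<open>i\<close>; it is positive semidefinite of rank
  \<open>min d (out_degree E i)\<close>. Hence the generalized kernel of \<open>L\<close> has codimension
  \<open>m = (\<Sum>i. min d (out_degree E i))\<close>, and as \<open>ker R \<subseteq> ker L\<close>, the operator \<open>L\<close> is injective modulo
  \<open>ker R\<close> if and only if \<open>R\<close> has rank \<open>m\<close>. The two dimension counts are
  \<open>dim_kernel_control_operator_square_le\<close> and \<open>dim_range_control_operator_le\<close>.

  A final subgraph \<open>E'\<close> of the deletion process has exactly \<open>m\<close> arcs, and its rigidity matrix has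
  independent rows, again by the ordering of the vertices. So \<open>R\<close> has rank \<open>m\<close> if and only if \<open>E\<close>
  and \<open>E'\<close> have the same infinitesimal motions (\<open>kernel_stretch_eq_if_bij\<close>,
  \<open>bij_if_kernel_stretch_eq\<close>). It remains to compare this with rigidity, which speaks about
  finite motions. The distance map of \<open>E'\<close> is a submersion, so its fibres are manifolds whose
  tangent spaces consist of the infinitesimal motions. If \<open>E\<close> and \<open>E'\<close> have the same infinitesimal
  motions near \<open>p\<close>, the distances of \<open>E\<close> are constant on these fibres
  (\<open>kernel_le_imp_constant_on_fibre\<close>), so rigidity passes from \<open>E\<close> to \<open>E'\<close>. Conversely, if \<open>E'\<close> is
  rigid, so is \<open>E\<close>, and the distances of \<open>E\<close> are constant on the fibres, which makes every
  infinitesimal motion of \<open>E'\<close> one of \<open>E\<close> (\<open>constant_on_fibre_imp_kernel_le\<close>).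
\<close>

section \<open>Rational polynomials and generic configurations\<close>

text \<open>
  Polynomials over \<open>\<rat>\<close> enter as functions, so that closure under the ring operations replaces
  computations with their coefficients.
\<close>

definition rat_polynomial :: "(('d::finite, 'v::finite) configuration \<Rightarrow> real) \<Rightarrow> bool" where
  "rat_polynomial f \<longleftrightarrow> (\<exists>P. f = eval_rat_poly P)"

lemma eval_rat_poly_add: "eval_rat_poly (P + Q) p = eval_rat_poly P p + eval_rat_poly Q p"
  unfolding eval_rat_poly_def
  by (rule setsum_keys_plus_distrib) (auto simp: of_rat_add algebra_simps)

lemma eval_rat_poly_zero: "eval_rat_poly 0 p = 0"
  unfolding eval_rat_poly_def by simp

lemma eval_rat_poly_sum: "eval_rat_poly (\<Sum>x\<in>A. P x) p = (\<Sum>x\<in>A. eval_rat_poly (P x) p)"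
  by (induction A rule: infinite_finite_induct) (auto simp: eval_rat_poly_zero eval_rat_poly_add)

lemma eval_rat_poly_single:
  "eval_rat_poly (Poly_Mapping.single m c) p =
     of_rat c * (\<Prod>i\<in>UNIV. \<Prod>k\<in>UNIV. (p $ i $ k) ^ Poly_Mapping.lookup m (i, k))"
  unfolding eval_rat_poly_def by simp

lemma rat_polynomial_const: "rat_polynomial (\<lambda>p. of_rat c)"
proof -
  have "(\<lambda>p. of_rat c) = eval_rat_poly (Poly_Mapping.single 0 c)"
    by (simp add: fun_eq_iff eval_rat_poly_single)
  then show ?thesis unfolding rat_polynomial_def by blast
qed

lemma rat_polynomial_coord: "rat_polynomial (\<lambda>p. p $ i $ k)"
proof -
  have "eval_rat_poly (Poly_Mapping.single (Poly_Mapping.single (i, k) 1) 1) p = p $ i $ k" for p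
  proof -
    have "(\<Prod>i'\<in>UNIV. \<Prod>k'\<in>UNIV. (p $ i' $ k') ^
            Poly_Mapping.lookup (Poly_Mapping.single (i, k) (1::nat)) (i', k')) =
          (\<Prod>i'\<in>UNIV. \<Prod>k'\<in>UNIV. if k' = k then (if i' = i then p $ i $ k else 1) else 1)"
      by (intro prod.cong refl) (auto simp: lookup_single when_def)
    then show ?thesis by (simp add: eval_rat_poly_single)
  qed
  then have "(\<lambda>p. p $ i $ k) = eval_rat_poly (Poly_Mapping.single (Poly_Mapping.single (i, k) 1) 1)"
    by (simp add: fun_eq_iff)
  then show ?thesis unfolding rat_polynomial_def by blast
qed

lemma rat_polynomial_add:
  "rat_polynomial f \<Longrightarrow> rat_polynomial g \<Longrightarrow> rat_polynomial (\<lambda>p. f p + g p)"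
  unfolding rat_polynomial_def by (auto simp flip: eval_rat_poly_add)

lemma rat_polynomial_mult:
  assumes "rat_polynomial f" "rat_polynomial g"
  shows "rat_polynomial (\<lambda>p. f p * g p)"
proof -
  obtain P Q where f: "f = eval_rat_poly P" and g: "g = eval_rat_poly Q"
    using assms unfolding rat_polynomial_def by blast
  let ?lp = "Poly_Mapping.lookup P" and ?lq = "Poly_Mapping.lookup Q"
  have "f p * g p = eval_rat_poly (\<Sum>m\<in>Poly_Mapping.keys P. \<Sum>n\<in>Poly_Mapping.keys Q.
          Poly_Mapping.single (m + n) (?lp m * ?lq n)) p" for p
    unfolding eval_rat_poly_sum eval_rat_poly_single lookup_add power_add prod.distrib of_rat_mult
    unfolding f g eval_rat_poly_def sum_product
    by (intro sum.cong refl) (simp add: ac_simps)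
  then have "(\<lambda>p. f p * g p) = eval_rat_poly (\<Sum>m\<in>Poly_Mapping.keys P. \<Sum>n\<in>Poly_Mapping.keys Q.
          Poly_Mapping.single (m + n) (?lp m * ?lq n))" by blast
  then show ?thesis unfolding rat_polynomial_def by blast
qed

lemma rat_polynomial_sum:
  "(\<And>x. x \<in> A \<Longrightarrow> rat_polynomial (f x)) \<Longrightarrow> rat_polynomial (\<lambda>p. \<Sum>x\<in>A. f x p)"
  by (induction A rule: infinite_finite_induct)
    (use rat_polynomial_const[of 0] in \<open>auto intro: rat_polynomial_add\<close>)

lemma rat_polynomial_prod:
  "(\<And>x. x \<in> A \<Longrightarrow> rat_polynomial (f x)) \<Longrightarrow> rat_polynomial (\<lambda>p. \<Prod>x\<in>A. f x p)"
  by (induction A rule: infinite_finite_induct)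
    (use rat_polynomial_const[of 1] in \<open>auto intro: rat_polynomial_mult\<close>)

lemma rat_polynomial_diff:
  assumes "rat_polynomial f" "rat_polynomial g"
  shows "rat_polynomial (\<lambda>p. f p - g p)"
  using rat_polynomial_add[OF assms(1) rat_polynomial_mult[OF rat_polynomial_const[of "-1"] assms(2)]]
  by simp

lemma rat_polynomial_det:
  fixes M :: "('d::finite, 'v::finite) configuration \<Rightarrow> real ^ 'n ^ 'n"
  assumes "\<And>i j. rat_polynomial (\<lambda>p. M p $ i $ j)"
  shows "rat_polynomial (\<lambda>p. det (M p))"
proof -
  have "rat_polynomial (\<lambda>p. of_int (sign \<pi>) :: real)" for \<pi> :: "'n \<Rightarrow> 'n"
    using rat_polynomial_const[of "of_int (sign \<pi>)"] by simp
  then show ?thesis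
    unfolding det_def by (intro rat_polynomial_sum rat_polynomial_mult rat_polynomial_prod assms)
qed

lemma continuous_on_rat_polynomial: "rat_polynomial f \<Longrightarrow> continuous_on UNIV f"
  unfolding rat_polynomial_def eval_rat_poly_def[abs_def]
  by (auto intro!: continuous_intros)

lemma rat_polynomial_on_line:
  assumes "rat_polynomial f"
  obtains a :: "real poly" where "\<And>t. f (p + t *\<^sub>R v) = poly a t"
proof -
  obtain P where f: "f = eval_rat_poly P" using assms unfolding rat_polynomial_def by blast
  show thesis
    by (rule that[of "\<Sum>m\<in>Poly_Mapping.keys P. [:of_rat (Poly_Mapping.lookup P m):] *
       (\<Prod>i\<in>UNIV. \<Prod>k\<in>UNIV. [:p $ i $ k, v $ i $ k:] ^ Poly_Mapping.lookup m (i, k))"])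
      (simp add: f eval_rat_poly_def poly_sum poly_prod poly_power)
qed

text \<open>
  The polynomial ring is a domain, seen on the line from \<open>p\<close> to \<open>q\<close>: there both functions become
  nonzero univariate polynomials, whose product has finitely many roots.
\<close>

lemma rat_polynomials_common_nonzero:
  assumes f: "rat_polynomial f" "f p \<noteq> 0" and g: "rat_polynomial g" "g q \<noteq> 0"
  shows "\<exists>r. f r * g r \<noteq> 0"
proof -
  obtain a where a: "\<And>t. f (p + t *\<^sub>R (q - p)) = poly a t"
    using rat_polynomial_on_line[OF f(1)] by blast
  obtain b where b: "\<And>t. g (p + t *\<^sub>R (q - p)) = poly b t"
    using rat_polynomial_on_line[OF g(1)] by blast
  have "a \<noteq> 0" using a[of 0] f(2) by auto
  moreover have "b \<noteq> 0" using b[of 1] g(2) by auto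
  ultimately have "finite {t. poly (a * b) t = 0}" by (intro poly_roots_finite) simp
  then obtain t where "poly (a * b) t \<noteq> 0"
    using infinite_UNIV_char_0[where ?'a = real] by (metis (mono_tags) UNIV_I finite_subset mem_Collect_eq subsetI)
  then have "f (p + t *\<^sub>R (q - p)) * g (p + t *\<^sub>R (q - p)) \<noteq> 0" by (simp add: a b)
  then show ?thesis by blast
qed

text \<open>
  A proper algebraic set lies in the zero set of a single nonzero polynomial, so generic properties
  are those that follow from the nonvanishing of one polynomial.
\<close>

lemma for_every_generic_iff:
  "for_every_generic P \<longleftrightarrow> (\<exists>f. rat_polynomial f \<and> (\<exists>p. f p \<noteq> 0) \<and> (\<forall>p. f p \<noteq> 0 \<longrightarrow> P p))"
  (is "_ \<longleftrightarrow> ?rhs")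
proof
  assume "for_every_generic P"
  then obtain S where S: "{p. \<forall>f\<in>S. eval_rat_poly f p = 0} \<noteq> UNIV"
    and P: "\<forall>p. p \<notin> {p. \<forall>f\<in>S. eval_rat_poly f p = 0} \<longrightarrow> P p"
    unfolding for_every_generic_def algebraic_over_rat_def by blast
  obtain p Q where "Q \<in> S" "eval_rat_poly Q p \<noteq> 0" using S by blast
  then show ?rhs using P unfolding rat_polynomial_def by blast
next
  assume ?rhs
  then obtain Q p where "eval_rat_poly Q p \<noteq> 0" "\<forall>p. eval_rat_poly Q p \<noteq> 0 \<longrightarrow> P p"
    unfolding rat_polynomial_def by blast
  then show "for_every_generic P"
    unfolding for_every_generic_def algebraic_over_rat_def
    by (intro exI[of _ "{p. \<forall>f\<in>{Q}. eval_rat_poly f p = 0}"]) auto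
qed

lemma for_every_generic_mono:
  "for_every_generic P \<Longrightarrow> (\<And>p. P p \<Longrightarrow> Q p) \<Longrightarrow> for_every_generic Q"
  unfolding for_every_generic_def by blast

lemma for_every_generic_conj:
  assumes "for_every_generic P" "for_every_generic Q"
  shows "for_every_generic (\<lambda>p. P p \<and> Q p)"
proof -
  obtain f p g q where f: "rat_polynomial f" "f p \<noteq> 0" "\<forall>p. f p \<noteq> 0 \<longrightarrow> P p"
    and g: "rat_polynomial g" "g q \<noteq> 0" "\<forall>p. g p \<noteq> 0 \<longrightarrow> Q p"
    using assms unfolding for_every_generic_iff by blast
  show ?thesis
    unfolding for_every_generic_iff
    using rat_polynomials_common_nonzero[OF f(1,2) g(1,2)] rat_polynomial_mult[OF f(1) g(1)] f(3) g(3)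
    by (intro exI[of _ "\<lambda>p. f p * g p"]) auto
qed

lemma for_every_generic_finite_ball:
  assumes "finite A" "\<And>x. x \<in> A \<Longrightarrow> for_every_generic (P x)"
  shows "for_every_generic (\<lambda>p. \<forall>x\<in>A. P x p)"
  using assms
proof (induction A)
  case empty
  have "for_every_generic (\<lambda>p. True)"
    unfolding for_every_generic_iff using rat_polynomial_const[of 1] by fastforce
  then show ?case by simp
next
  case (insert x A)
  then show ?case by (simp add: for_every_generic_conj)
qed

text \<open>
  The nonvanishing of a polynomial is an open condition. This gives constant rank of the rigidity
  matrix around a generic configuration.
\<close>

lemma for_every_generic_eventually:
  assumes "for_every_generic P"
  shows "for_every_generic (\<lambda>p. \<forall>\<^sub>F q in nhds p. P q)"
proof -
  obtain f where f: "rat_polynomial f" "\<exists>p. f p \<noteq> 0" "\<forall>p. f p \<noteq> 0 \<longrightarrow> P p"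
    using assms unfolding for_every_generic_iff by blast
  have "\<forall>\<^sub>F q in nhds p. P q" if "f p \<noteq> 0" for p
  proof -
    have "open {q. f q \<noteq> 0}"
      by (intro open_Collect_neq continuous_on_rat_polynomial[OF f(1)] continuous_on_const)
    then have "\<forall>\<^sub>F q in nhds p. q \<in> {q. f q \<noteq> 0}" using that by (intro eventually_nhds_in_open) auto
    then show ?thesis by eventually_elim (use f(3) in auto)
  qed
  then show ?thesis unfolding for_every_generic_iff using f(1,2) by blast
qed

text \<open>
  At every vertex the directions to at most \<open>d\<close> other vertices are linearly independent;
  \<open>inj_on\<close> is needed because independence of the image does not count repeated directions.
\<close>

definition general_position :: "('d::finite, 'v::finite) configuration \<Rightarrow> bool" where
  "general_position p \<longleftrightarrow>
     (\<forall>i J. i \<notin> J \<and> card J \<le> CARD('d) \<longrightarrow>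
        inj_on (\<lambda>j. p $ i - p $ j) J \<and> independent ((\<lambda>j. p $ i - p $ j) ` J))"

text \<open>
  The directions are completed to a \<open>d \<times> d\<close> matrix by standard unit rows; its determinant is a
  rational polynomial in \<open>p\<close>, and it does not vanish identically because the directions can be
  prescribed to be the missing unit vectors.
\<close>

lemma generic_independent_directions:
  fixes i :: "'v::finite" and J :: "'v set"
  assumes "i \<notin> J" "card J \<le> CARD('d)"
  shows "for_every_generic (\<lambda>p :: ('d::finite, 'v) configuration.
           inj_on (\<lambda>j. p $ i - p $ j) J \<and> independent ((\<lambda>j. p $ i - p $ j) ` J))"
proof -
  obtain e :: "'v \<Rightarrow> 'd" where e: "inj_on e J"
    using card_le_inj[of J "UNIV :: 'd set"] assms(2) by auto
  define M :: "('d, 'v) configuration \<Rightarrow> real ^ 'd ^ 'd" where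
    "M p = (\<chi> k. if k \<in> e ` J then p $ i - p $ (the_inv_into J e k) else axis k 1)" for p
  have M_row: "row (e j) (M p) = p $ i - p $ j" if "j \<in> J" for j p
    using that by (simp add: M_def row_def vec_eq_iff the_inv_into_f_f[OF e])
  have poly: "rat_polynomial (\<lambda>p. det (M p))"
  proof (rule rat_polynomial_det)
    fix k l :: 'd
    have "rat_polynomial (\<lambda>p :: ('d, 'v) configuration. axis k 1 $ l)"
      using rat_polynomial_const[of 0] rat_polynomial_const[of 1] by (auto simp: axis_def)
    then show "rat_polynomial (\<lambda>p. M p $ k $ l)"
      by (cases "k \<in> e ` J") (auto simp: M_def intro!: rat_polynomial_diff rat_polynomial_coord)
  qed
  define p0 :: "('d, 'v) configuration" where
    "p0 = (\<chi> j. if j = i then 0 else - axis (e j) 1)"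
  have "M p0 = mat 1"
    using assms(1)
    by (auto simp: M_def p0_def vec_eq_iff mat_def axis_def the_inv_into_f_f[OF e])
  then have "det (M p0) \<noteq> 0" by simp
  moreover have "inj_on (\<lambda>j. p $ i - p $ j) J \<and> independent ((\<lambda>j. p $ i - p $ j) ` J)"
    if nz: "det (M p) \<noteq> 0" for p
  proof
    show inj: "inj_on (\<lambda>j. p $ i - p $ j) J"
    proof (rule inj_onI)
      fix j k assume jk: "j \<in> J" "k \<in> J" "p $ i - p $ j = p $ i - p $ k"
      then have "row (e j) (M p) = row (e k) (M p)" by (simp add: M_row)
      then have "e j = e k" using nz det_identical_rows by metis
      then show "j = k" using e jk inj_onD by metis
    qed
    have "independent (rows (M p))"
      using nz det_dependent_rows by (metis dependent_vec_eq)
    then show "independent ((\<lambda>j. p $ i - p $ j) ` J)"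
      by (rule real_vector.independent_mono) (auto simp: rows_def simp flip: M_row)
  qed
  ultimately show ?thesis
    unfolding for_every_generic_iff using poly by blast
qed

lemma generic_general_position:
  "for_every_generic (general_position :: ('d::finite, 'v::finite) configuration \<Rightarrow> bool)"
proof -
  have "for_every_generic (\<lambda>p :: ('d, 'v) configuration. \<forall>(i, J)\<in>{(i, J). i \<notin> J \<and> card J \<le> CARD('d)}.
          inj_on (\<lambda>j. p $ i - p $ j) J \<and> independent ((\<lambda>j. p $ i - p $ j) ` J))"
    by (rule for_every_generic_finite_ball) (auto intro: generic_independent_directions)
  then show ?thesis
    by (rule for_every_generic_mono) (auto simp: general_position_def)
qed

section \<open>Dimension counts along an ordering of the vertices\<close>

lemma dim_le_image_plus_kernel:
  fixes f :: "'a::euclidean_space \<Rightarrow> 'b::euclidean_space"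
  assumes "linear f" "subspace W"
  shows "dim W \<le> dim (f ` W) + dim {x \<in> W. f x = 0}"
proof -
  interpret linear f by fact
  let ?K = "{x \<in> W. f x = 0}"
  let ?C = "{y \<in> W. \<forall>x\<in>?K. orthogonal x y}"
  have K: "subspace ?K" using assms(2) by (auto simp: subspace_def add scaleR zero)
  have C: "subspace ?C"
    using assms(2) by (auto simp: subspace_def orthogonal_def inner_add_right)
  have "dim ?C + dim ?K = dim W"
    by (rule dim_subspace_orthogonal_to_vectors[OF K assms(2)]) auto
  moreover have "inj_on f (span ?C)"
  proof (subst span_eq_iff[THEN iffD2, OF C], rule inj_onI)
    fix x y assume xy: "x \<in> ?C" "y \<in> ?C" "f x = f y"
    then have "x - y \<in> ?C" "x - y \<in> ?K"
      using subspace_diff[OF C, of x y] subspace_diff[OF assms(2), of x y] by (auto simp: diff)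
    then show "x = y" by (auto simp: orthogonal_def)
  qed
  then have "dim (f ` ?C) = dim ?C" by (rule dim_image_eq[OF assms(1)])
  moreover have "dim (f ` ?C) \<le> dim (f ` W)" by (intro dim_subset image_mono) auto
  ultimately show ?thesis by simp
qed

text \<open>
  The projections to the graded pieces of the flag that the ordering \<open>r\<close> of the vertices defines on
  the configurations; the piece at \<open>i\<close> sees the vectors of \<open>W\<close> that vanish before \<open>i\<close>.
\<close>

definition leading_entries :: "('v::finite \<Rightarrow> nat) \<Rightarrow> (real ^ 'd::finite ^ 'v) set \<Rightarrow> 'v \<Rightarrow> (real ^ 'd) set" where
  "leading_entries r W i = {x $ i |x. x \<in> W \<and> (\<forall>j. r j < r i \<longrightarrow> x $ j = 0)}"

text \<open>
  Removing the first vertex of \<open>B\<close> splits off its entries as an image of \<open>W\<close> and leaves the vectors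
  of \<open>W\<close> that vanish there.
\<close>

lemma dim_le_sum_leading_entries_supported:
  fixes W :: "(real ^ 'd::finite ^ 'v::finite) set"
  assumes r: "inj r" and "finite B" "subspace W" "\<And>x i. x \<in> W \<Longrightarrow> i \<notin> B \<Longrightarrow> x $ i = 0"
  shows "dim W \<le> (\<Sum>i\<in>B. dim (leading_entries r W i))"
  using assms(2-)
proof (induction "card B" arbitrary: B W)
  case 0
  then have "W \<subseteq> {0}" by (auto simp: vec_eq_iff)
  then have "dim W = 0" by simp
  then show ?case by linarith
next
  case (Suc n)
  then have "B \<noteq> {}" by auto
  then obtain i where i: "i \<in> B" "\<And>j. j \<in> B \<Longrightarrow> r i \<le> r j"
    using ex_min_if_finite[of "r ` B"] Suc.prems(1) by (auto simp: not_less)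
  let ?W' = "{x \<in> W. x $ i = 0}"
  have lin: "linear (\<lambda>x :: real ^ 'd ^ 'v. x $ i)" by (intro linearI) auto
  have sub: "subspace ?W'" using Suc.prems(2) by (auto simp: subspace_def)
  have "dim ?W' \<le> (\<Sum>j\<in>B - {i}. dim (leading_entries r ?W' j))"
    by (rule Suc.hyps(1)) (use Suc i sub in auto)
  also have "\<dots> \<le> (\<Sum>j\<in>B - {i}. dim (leading_entries r W j))"
    by (intro sum_mono dim_subset) (auto simp: leading_entries_def)
  finally have rest: "dim ?W' \<le> (\<Sum>j\<in>B - {i}. dim (leading_entries r W j))" .
  have "(\<lambda>x. x $ i) ` W = leading_entries r W i"
  proof -
    have "x $ j = 0" if "x \<in> W" "r j < r i" for x j
      using that i Suc.prems(3) by (meson leD)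
    then show ?thesis by (auto simp: leading_entries_def)
  qed
  then have "dim W \<le> dim (leading_entries r W i) + dim ?W'"
    using dim_le_image_plus_kernel[OF lin Suc.prems(2)] by simp
  with rest show ?case using i Suc.prems(1) by (simp add: sum.remove)
qed

lemma dim_le_sum_leading_entries:
  fixes W :: "(real ^ 'd::finite ^ 'v::finite) set"
  assumes "inj r" "subspace W"
  shows "dim W \<le> (\<Sum>i\<in>UNIV. dim (leading_entries r W i))"
  by (rule dim_le_sum_leading_entries_supported) (use assms in auto)

text \<open>
  The number of vertices reachable from \<open>i\<close> decreases along arcs; ties are broken by an arbitrary
  enumeration of the vertices.
\<close>

lemma acyclic_finite_ranking:
  fixes E :: "('v::finite \<times> 'v) set"
  assumes "acyclic E"
  obtains r :: "'v \<Rightarrow> nat" where "inj r" "\<And>i j. (i, j) \<in> E \<Longrightarrow> r j < r i"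
proof -
  obtain h :: "'v \<Rightarrow> nat" and N where h: "inj h" "range h = {i. i < N}"
    using finite_imp_inj_to_nat_seg[of "UNIV :: 'v set"] by auto
  have hN: "h i < N" for i using h(2) by blast
  define c where "c i = card {j. (i, j) \<in> E\<^sup>+}" for i
  have less: "c j < c i" if "(i, j) \<in> E" for i j
  proof -
    have "{k. (j, k) \<in> E\<^sup>+} \<subset> {k. (i, k) \<in> E\<^sup>+}"
      using that assms by (auto simp: acyclic_def intro: trancl_into_trancl2)
    then show ?thesis unfolding c_def by (intro psubset_card_mono) auto
  qed
  define r where "r i = c i * N + h i" for i
  have divmod: "r i div N = c i" "r i mod N = h i" for i
    using hN[of i] by (auto simp: r_def)
  show thesis
  proof
    show "inj r" by (metis divmod(2) h(1) injD injI)
    fix i j assume "(i, j) \<in> E"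
    then have "r j div N < r i div N" by (simp add: divmod less)
    then show "r j < r i" by (meson div_le_mono leD not_le)
  qed
qed

section \<open>Fibres of submersions\<close>

text \<open>
  Around \<open>p\<close> the fibre of \<open>f\<close> is parametrized by the kernel \<open>K\<close> of its derivative. The hypothesis on
  \<open>f q - f p\<close> says that \<open>f\<close> takes its values in an affine translate of the image of \<open>f' p\<close>, that is,
  \<open>f\<close> is a submersion onto that translate. The chart combines the adjoint of \<open>f' p\<close>, whose image is
  orthogonal to \<open>K\<close>, with a projection to \<open>K\<close>; this keeps source and target equal, as the inverse
  function theorem requires, and \<open>f q = f p\<close> becomes \<open>\<phi> q \<in> K\<close>.
\<close>

lemma submersion_chart:
  fixes f :: "'a::euclidean_space \<Rightarrow> 'b::euclidean_space"
  assumes der: "\<And>q. (f has_derivative f' q) (at q)"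
    and cont: "\<And>v. continuous_on UNIV (\<lambda>q. f' q v)"
    and sub: "\<And>q. f q - f p \<in> range (f' p)"
  obtains \<phi> g :: "'a \<Rightarrow> 'a" and g' \<epsilon> where "\<epsilon> > 0" "g 0 = p"
    "\<And>y. y \<in> ball 0 \<epsilon> \<Longrightarrow> (g has_derivative g' y) (at y)"
    "\<And>y. f' p y = 0 \<Longrightarrow> g' 0 y = y"
    "\<And>y. y \<in> ball 0 \<epsilon> \<Longrightarrow> f' p y = 0 \<Longrightarrow> f (g y) = f p"
    "\<And>q. f q = f p \<Longrightarrow> f' p (\<phi> q) = 0"
    "(\<phi> \<longlongrightarrow> 0) (nhds p)" "\<forall>\<^sub>F q in nhds p. g (\<phi> q) = q"
proof -
  define T where "T = f' p"
  have lin: "linear (f' q)" for q using der has_derivative_linear by blast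
  have linT: "linear T" unfolding T_def by (rule lin)
  interpret T: linear T by (rule linT)
  define K where "K = {x. T x = 0}"
  have K: "subspace K" by (auto simp: K_def subspace_def T.add T.scaleR T.zero)
  have "\<exists>N. range N \<subseteq> K \<and> linear N \<and> (\<forall>v\<in>K. N (id v) = v)"
    by (rule linear_exists_left_inverse_on[OF linear_id K]) auto
  then obtain N :: "'a \<Rightarrow> 'a" where N: "range N \<subseteq> K" "linear N" "\<And>v. v \<in> K \<Longrightarrow> N v = v" by auto
  interpret N: linear N by (rule N(2))
  define S where "S = adjoint T"
  have adj: "x \<bullet> S y = T x \<bullet> y" for x y unfolding S_def by (rule adjoint_works[OF linT])
  have linS: "linear S" unfolding S_def by (rule adjoint_linear[OF linT])
  interpret S: linear S by (rule linS)
  have KS: "S y = 0" if "S y \<in> K" for y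
    using adj[of "S y" y] that by (simp add: K_def)
  have rangeT: "w = 0" if "w \<in> range T" "S w = 0" for w
  proof -
    obtain x where "w = T x" using \<open>w \<in> range T\<close> by blast
    then show ?thesis using adj[of x w] \<open>S w = 0\<close> by simp
  qed
  define \<phi> where "\<phi> q = S (f q - f p) + N (q - p)" for q
  define \<phi>' where "\<phi>' q v = S (f' q v) + N v" for q v
  have lin\<phi>': "linear (\<phi>' q)" for q
    unfolding \<phi>'_def by (intro linear_compose_add N(2) linear_compose[OF lin linS, unfolded o_def])
  have der\<phi>: "(\<phi> has_derivative \<phi>' q) (at q)" for q
    unfolding \<phi>_def \<phi>'_def
    by (auto intro!: derivative_eq_intros der linear_imp_has_derivative
        bounded_linear.has_derivative[OF linear_conv_bounded_linear[THEN iffD1, OF linS]]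
        bounded_linear.has_derivative[OF linear_conv_bounded_linear[THEN iffD1, OF N(2)]])
  define D where "D q = Blinfun (\<phi>' q)" for q
  have D: "blinfun_apply (D q) = \<phi>' q" for q
    unfolding D_def using lin\<phi>' by (intro bounded_linear_Blinfun_apply) (simp add: linear_conv_bounded_linear)
  have contD: "continuous_on UNIV D"
  proof (rule continuous_on_blinfun_componentwise)
    fix i :: 'a assume "i \<in> Basis"
    show "continuous_on UNIV (\<lambda>q. blinfun_apply (D q) i)"
      unfolding D \<phi>'_def
      by (intro continuous_intros cont
          continuous_on_compose2[OF linear_continuous_on[OF linear_conv_bounded_linear[THEN iffD1, OF linS], of UNIV] cont])
        auto
  qed
  have inj: "inj (\<phi>' p)"
  proof -
    have "x = 0" if "\<phi>' p x = 0" for x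
    proof -
      have "T (N x) = 0" using N(1) by (auto simp: K_def)
      then have "N x \<bullet> S (T x) = 0" by (simp add: adj)
      moreover have eq: "S (T x) + N x = 0" using that by (simp add: \<phi>'_def T_def)
      then have "N x \<bullet> S (T x) + N x \<bullet> N x = 0" by (metis inner_add_right inner_zero_right)
      ultimately have "N x = 0" by simp
      then have "T x = 0" using eq rangeT by simp
      then show ?thesis using N(3)[of x] \<open>N x = 0\<close> by (simp add: K_def)
    qed
    then show ?thesis using linear_injective_0[OF lin\<phi>'] by blast
  qed
  then obtain I where I: "linear I" "I \<circ> \<phi>' p = id"
    using linear_injective_left_inverse[OF lin\<phi>'] by blast
  have inv: "Blinfun I o\<^sub>L D p = id_blinfun"
    using I by (intro blinfun_eqI)
      (simp add: D bounded_linear_Blinfun_apply linear_conv_bounded_linear pointfree_idE)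
  have derD: "(\<phi> has_derivative blinfun_apply (D q)) (at q)" for q
    unfolding D by (rule der\<phi>)
  obtain U V g g' where UV: "open U" "p \<in> U" "open V" "\<phi> p \<in> V" "homeomorphism U V \<phi> g"
    and g': "\<And>y. y \<in> V \<Longrightarrow> (g has_derivative (g' y)) (at y)"
      "\<And>y. y \<in> V \<Longrightarrow> g' y = inv (blinfun_apply (D (g y)))"
    by (rule inverse_function_theorem[OF open_UNIV derD contD UNIV_I inv]) blast
  have \<phi>p: "\<phi> p = 0" by (simp add: \<phi>_def S.zero N.zero)
  have gp: "g 0 = p" using UV(2,5) \<phi>p by (metis homeomorphism_apply1)
  obtain \<epsilon> where \<epsilon>: "\<epsilon> > 0" "ball 0 \<epsilon> \<subseteq> V"
    using UV(3,4) unfolding \<phi>p open_contains_ball by blast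
  show thesis
  proof (rule that[of \<epsilon> g g' \<phi>])
    show "\<epsilon> > 0" "g 0 = p" by (fact \<epsilon>(1), fact gp)
  next
    fix y :: 'a assume y: "y \<in> ball 0 \<epsilon>"
    then show "(g has_derivative g' y) (at y)" using g'(1) \<epsilon>(2) by blast
    assume y0: "f' p y = 0"
    have "\<phi> (g y) = y" using UV(5) y \<epsilon>(2) by (meson homeomorphism_apply2 subsetD)
    then have "\<phi> (g y) \<in> K" using y0 by (simp add: K_def T_def)
    moreover have "N (g y - p) \<in> K" using N(1) by blast
    ultimately have "\<phi> (g y) - N (g y - p) \<in> K" by (rule subspace_diff[OF K])
    then have "S (f (g y) - f p) \<in> K" by (simp add: \<phi>_def)
    then have "f (g y) - f p = 0" using KS rangeT sub unfolding T_def by blast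
    then show "f (g y) = f p" by simp
  next
    fix y assume y: "f' p y = 0"
    have "\<phi>' p y = y" using y N(3)[of y] by (simp add: \<phi>'_def K_def T_def S.zero)
    then have "inv (\<phi>' p) y = y" using inj by (metis inv_f_f)
    then show "g' 0 y = y" using g'(2)[of 0] UV(4) \<phi>p gp D by simp
  next
    fix q assume "f q = f p"
    then show "f' p (\<phi> q) = 0" using N(1) by (auto simp: \<phi>_def S.zero K_def T_def)
  next
    have "isCont \<phi> p" using der\<phi> has_derivative_continuous by blast
    then show "(\<phi> \<longlongrightarrow> 0) (nhds p)"
      using \<phi>p tendsto_at_iff_tendsto_nhds[of \<phi> p] by (simp add: continuous_at)
  next
    have "\<forall>\<^sub>F q in nhds p. q \<in> U" using UV(1,2) by (rule eventually_nhds_in_open)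
    then show "\<forall>\<^sub>F q in nhds p. g (\<phi> q) = q"
      by eventually_elim (use UV(5) in \<open>auto simp: homeomorphism_apply1\<close>)
  qed
qed

text \<open>
  Every vector in the kernel of \<open>f' p\<close> is the velocity of a curve in the fibre, along which \<open>h\<close> is
  constant.
\<close>

lemma constant_on_fibre_imp_kernel_le:
  fixes f :: "'a::euclidean_space \<Rightarrow> 'b::euclidean_space" and h :: "'a \<Rightarrow> 'c::real_normed_vector"
  assumes "\<And>q. (f has_derivative f' q) (at q)"
    and "\<And>v. continuous_on UNIV (\<lambda>q. f' q v)"
    and "\<And>q. f q - f p \<in> range (f' p)"
    and h: "(h has_derivative h') (at p)"
    and const: "\<forall>\<^sub>F q in nhds p. f q = f p \<longrightarrow> h q = h p"
    and v: "f' p v = 0"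
  shows "h' v = 0"
proof -
  obtain \<phi> g :: "'a \<Rightarrow> 'a" and g' \<epsilon> where \<epsilon>: "\<epsilon> > 0" and g0: "g 0 = p"
    and g: "\<And>y. y \<in> ball 0 \<epsilon> \<Longrightarrow> (g has_derivative g' y) (at y)"
    and g'0: "\<And>y. f' p y = 0 \<Longrightarrow> g' 0 y = y"
    and fg: "\<And>y. y \<in> ball 0 \<epsilon> \<Longrightarrow> f' p y = 0 \<Longrightarrow> f (g y) = f p"
    by (rule submersion_chart[OF assms(1-3)]) blast
  have lin: "linear (f' p)" using assms(1) has_derivative_linear by blast
  have line: "((\<lambda>t. t *\<^sub>R v) has_derivative (\<lambda>t. t *\<^sub>R v)) (at (0::real))"
    by (auto intro!: derivative_eq_intros)
  have "(g has_derivative g' 0) (at (0 *\<^sub>R v))" using g[of 0] \<epsilon> by simp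
  from has_derivative_compose[OF line this]
  have c: "((\<lambda>t. g (t *\<^sub>R v)) has_derivative (\<lambda>t. g' 0 (t *\<^sub>R v))) (at 0)" .
  have "(h has_derivative h') (at (g (0 *\<^sub>R v)))" using h g0 by simp
  from has_derivative_compose[OF c this]
  have d1: "((\<lambda>t. h (g (t *\<^sub>R v))) has_derivative (\<lambda>t. h' (g' 0 (t *\<^sub>R v)))) (at 0)" .
  have tend: "((\<lambda>t. g (t *\<^sub>R v)) \<longlongrightarrow> p) (at 0)"
    using has_derivative_continuous[OF c] g0 by (simp add: continuous_at)
  then have "\<forall>\<^sub>F t in at 0. f (g (t *\<^sub>R v)) = f p \<longrightarrow> h (g (t *\<^sub>R v)) = h p"
    using const unfolding filterlim_iff by blast
  moreover have "\<forall>\<^sub>F t in at (0::real). t *\<^sub>R v \<in> ball 0 \<epsilon>"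
  proof -
    have "((\<lambda>t. t *\<^sub>R v) \<longlongrightarrow> 0) (at (0::real))" by (auto intro!: tendsto_eq_intros)
    then show ?thesis using \<epsilon> by (intro topological_tendstoD) auto
  qed
  ultimately have "\<forall>\<^sub>F t in at 0. h (g (t *\<^sub>R v)) = h p"
    by eventually_elim (use fg v lin in \<open>auto simp: linear_scale\<close>)
  then have d2: "((\<lambda>t. h (g (t *\<^sub>R v))) has_derivative (\<lambda>t. 0)) (at (0::real))"
    by (intro has_derivative_transform_eventually[OF has_derivative_const[of "h p"]])
      (auto elim: eventually_mono simp: g0)
  have "h' (g' 0 (1 *\<^sub>R v)) = 0" using has_derivative_unique[OF d1 d2] by meson
  then show ?thesis using g'0[OF v] by simp
qed

text \<open>
  The chart maps a segment in the kernel to a curve in the fibre that joins \<open>q\<close> to \<open>p\<close>. Its velocity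
  lies in the kernel of the derivative of \<open>f\<close> at the point reached, so \<open>h\<close> does not change along it.
\<close>

lemma kernel_le_imp_constant_on_fibre:
  fixes f :: "'a::euclidean_space \<Rightarrow> 'b::euclidean_space" and h :: "'a \<Rightarrow> 'c::euclidean_space"
  assumes der: "\<And>q. (f has_derivative f' q) (at q)"
    and "\<And>v. continuous_on UNIV (\<lambda>q. f' q v)"
    and "\<And>q. f q - f p \<in> range (f' p)"
    and h: "\<And>q. (h has_derivative h' q) (at q)"
    and ker: "\<forall>\<^sub>F q in nhds p. \<forall>v. f' q v = 0 \<longrightarrow> h' q v = 0"
  shows "\<forall>\<^sub>F q in nhds p. f q = f p \<longrightarrow> h q = h p"
proof -
  obtain \<phi> g :: "'a \<Rightarrow> 'a" and g' \<epsilon> where \<epsilon>: "\<epsilon> > 0" and g0: "g 0 = p"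
    and g: "\<And>y. y \<in> ball 0 \<epsilon> \<Longrightarrow> (g has_derivative g' y) (at y)"
    and fg: "\<And>y. y \<in> ball 0 \<epsilon> \<Longrightarrow> f' p y = 0 \<Longrightarrow> f (g y) = f p"
    and \<phi>: "\<And>q. f q = f p \<Longrightarrow> f' p (\<phi> q) = 0"
    and \<phi>0: "(\<phi> \<longlongrightarrow> 0) (nhds p)" and near: "\<forall>\<^sub>F q in nhds p. g (\<phi> q) = q"
    by (rule submersion_chart[OF assms(1-3)]) blast
  have lin: "linear (f' p)" using assms(1) has_derivative_linear by blast
  have "isCont g 0" using g[of 0] \<epsilon> has_derivative_continuous by force
  then have "(g \<longlongrightarrow> p) (nhds 0)"
    using g0 tendsto_at_iff_tendsto_nhds[of g 0] by (simp add: continuous_at)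
  then have "\<forall>\<^sub>F y in nhds 0. \<forall>v. f' (g y) v = 0 \<longrightarrow> h' (g y) v = 0"
    using ker unfolding filterlim_iff by blast
  then obtain \<delta> where \<delta>: "\<delta> > 0"
    "\<And>y v. y \<in> ball 0 \<delta> \<Longrightarrow> f' (g y) v = 0 \<Longrightarrow> h' (g y) v = 0"
    unfolding eventually_nhds_metric by (auto simp: dist_commute)
  define \<rho> where "\<rho> = min \<delta> \<epsilon>"
  have \<rho>: "\<rho> > 0" "ball 0 \<rho> \<subseteq> ball (0::'a) \<delta>" "ball 0 \<rho> \<subseteq> ball (0::'a) \<epsilon>"
    using \<delta>(1) \<epsilon> by (auto simp: \<rho>_def)
  have const: "h (g y) = h p" if y: "y \<in> ball 0 \<rho>" and y0: "f' p y = 0" for y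
  proof -
    have ty: "t *\<^sub>R y \<in> ball 0 \<rho>" "f' p (t *\<^sub>R y) = 0" if "t \<in> {0..1}" for t
    proof -
      have "norm (t *\<^sub>R y) \<le> norm y" using that by (simp add: mult_left_le_one_le)
      then show "t *\<^sub>R y \<in> ball 0 \<rho>" using y by simp
      show "f' p (t *\<^sub>R y) = 0" using y0 lin by (simp add: linear_scale)
    qed
    have dg: "((\<lambda>t. g (t *\<^sub>R y)) has_derivative (\<lambda>s. g' (t *\<^sub>R y) (s *\<^sub>R y))) (at t within {0..1})"
      if t: "t \<in> {0..1}" for t
    proof -
      have line: "((\<lambda>t. t *\<^sub>R y) has_derivative (\<lambda>s. s *\<^sub>R y)) (at t within {0..1})"
        by (auto intro!: derivative_eq_intros)
      have "(g has_derivative g' (t *\<^sub>R y)) (at (t *\<^sub>R y))"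
        using g ty(1)[OF t] \<rho>(3) by blast
      from has_derivative_compose[OF line this] show ?thesis .
    qed
    have dh: "((\<lambda>t. h (g (t *\<^sub>R y))) has_derivative (\<lambda>s. 0)) (at t within {0..1})"
      if t: "t \<in> {0..1}" for t
    proof -
      have "((\<lambda>t. f (g (t *\<^sub>R y))) has_derivative
          (\<lambda>s. f' (g (t *\<^sub>R y)) (g' (t *\<^sub>R y) (s *\<^sub>R y)))) (at t within {0..1})"
        by (rule has_derivative_compose[OF dg[OF t] der])
      moreover have "((\<lambda>t. f (g (t *\<^sub>R y))) has_derivative (\<lambda>s. 0)) (at t within {0..1})"
        by (rule has_derivative_transform[OF t _ has_derivative_const[of "f p"]])
          (use fg ty \<rho>(3) in blast)
      ultimately have "(\<lambda>s. f' (g (t *\<^sub>R y)) (g' (t *\<^sub>R y) (s *\<^sub>R y))) = (\<lambda>s. 0)"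
        using t by (intro frechet_derivative_unique_within_closed_interval[of 0 1 t]) auto
      then have "h' (g (t *\<^sub>R y)) (g' (t *\<^sub>R y) (s *\<^sub>R y)) = 0" for s
        using \<delta>(2)[OF subsetD[OF \<rho>(2) ty(1)[OF t]]] by (simp add: fun_eq_iff)
      moreover have "((\<lambda>t. h (g (t *\<^sub>R y))) has_derivative
          (\<lambda>s. h' (g (t *\<^sub>R y)) (g' (t *\<^sub>R y) (s *\<^sub>R y)))) (at t within {0..1})"
        by (rule has_derivative_compose[OF dg[OF t] h])
      ultimately show ?thesis by simp
    qed
    have "h (g (1 *\<^sub>R y)) = h (g (0 *\<^sub>R y))"
      by (rule has_derivative_zero_unique[of "{0..1::real}" "\<lambda>t. h (g (t *\<^sub>R y))"]) (use dh in auto)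
    then show ?thesis by (simp add: g0)
  qed
  have "\<forall>\<^sub>F q in nhds p. \<phi> q \<in> ball 0 \<rho>"
    using \<rho>(1) by (intro topological_tendstoD[OF \<phi>0]) auto
  with near show ?thesis
    by eventually_elim (metis const \<phi>)
qed

section \<open>The edge operator on configurations\<close>

text \<open>
  The rigidity matrix as an operator on configurations, instead of on vectors indexed by
  \<open>'v \<times> 'd\<close>.
\<close>

definition stretch ::
  "('v::finite \<times> 'v) set \<Rightarrow> ('d::finite, 'v) configuration \<Rightarrow> ('d, 'v) configuration \<Rightarrow> real ^ ('v \<times> 'v)" where
  "stretch E p x =
     (\<chi> e. if e \<in> E then (p $ fst e - p $ snd e) \<bullet> (x $ fst e - x $ snd e) else 0)"

text \<open>
  The product of the transposed directed rigidity matrix with the rigidity matrix, again on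
  configurations.
\<close>

definition control_operator ::
  "('v::finite \<times> 'v) set \<Rightarrow> ('d::finite, 'v) configuration \<Rightarrow> ('d, 'v) configuration \<Rightarrow> ('d, 'v) configuration" where
  "control_operator E p x =
     (\<chi> i. \<Sum>j | (i, j) \<in> E. ((p $ i - p $ j) \<bullet> (x $ i - x $ j)) *\<^sub>R (p $ i - p $ j))"

lemma stretch_eq_0_iff:
  "stretch E p x = 0 \<longleftrightarrow> (\<forall>i j. (i, j) \<in> E \<longrightarrow> (p $ i - p $ j) \<bullet> (x $ i - x $ j) = 0)"
  by (auto simp: stretch_def vec_eq_iff)

lemma bounded_bilinear_stretch: "bounded_bilinear (stretch E)"
  unfolding bilinear_conv_bounded_bilinear[symmetric] bilinear_def
  by (auto intro!: linearI simp: stretch_def vec_eq_iff algebra_simps inner_simps)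

lemma linear_stretch: "linear (stretch E p)"
  by (auto intro!: linearI simp: stretch_def vec_eq_iff algebra_simps inner_simps)

lemma linear_control_operator: "linear (control_operator E p)"
proof (rule linearI)
  show "control_operator E p (x + y) = control_operator E p x + control_operator E p y" for x y
    by (simp add: control_operator_def vec_eq_iff sum.distrib[symmetric] inner_simps algebra_simps)
  show "control_operator E p (c *\<^sub>R x) = c *\<^sub>R control_operator E p x" for c x
    by (simp add: control_operator_def vec_eq_iff sum_distrib_left inner_simps algebra_simps)
qed

lemma stretch_imp_control_operator_0: "stretch E p x = 0 \<Longrightarrow> control_operator E p x = 0"
  unfolding stretch_eq_0_iff control_operator_def by (simp add: vec_eq_iff)

lemma stretch_commute: "stretch E p x = stretch E x p"
  by (auto simp: stretch_def vec_eq_iff inner_commute)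

lemma distance_map_eq_stretch: "distance_map E p = stretch E p p"
  by (auto simp: distance_map_def stretch_def vec_eq_iff power2_norm_eq_inner
      norm_minus_commute simp flip: power2_norm_eq_inner)

lemma has_derivative_distance_map:
  "(distance_map E has_derivative (\<lambda>v. 2 *\<^sub>R stretch E q v)) (at q)"
proof -
  have "((\<lambda>p. stretch E p p) has_derivative (\<lambda>v. stretch E q v + stretch E v q)) (at q)"
    by (rule bounded_bilinear.FDERIV[OF bounded_bilinear_stretch]) (auto intro: derivative_intros)
  then show ?thesis
    by (simp add: distance_map_eq_stretch[abs_def] stretch_commute[of E _ q] scaleR_2)
qed

lemma continuous_on_stretch: "continuous_on UNIV (\<lambda>q. 2 *\<^sub>R stretch E q v)"
  by (intro continuous_intros bounded_bilinear.continuous_on[OF bounded_bilinear_stretch])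

lemma distance_map_eq_iff:
  "distance_map E q = distance_map E p \<longleftrightarrow>
     (\<forall>i j. (i, j) \<in> E \<longrightarrow> norm (q $ j - q $ i) = norm (p $ j - p $ i))"
proof -
  have "distance_map E q = distance_map E p \<longleftrightarrow>
      (\<forall>i j. (i, j) \<in> E \<longrightarrow> (norm (q $ j - q $ i))\<^sup>2 = (norm (p $ j - p $ i))\<^sup>2)"
    unfolding distance_map_def vec_eq_iff by (simp add: split_paired_all if_split_eq1)
  then show ?thesis by simp
qed

lemma distance_map_underlying_graph_eq_iff:
  "distance_map (underlying_graph E) q = distance_map (underlying_graph E) p \<longleftrightarrow>
     distance_map E q = distance_map E p"
  unfolding distance_map_eq_iff underlying_graph_def
  by (metis Un_iff converse_iff norm_minus_commute)

lemma rigidity_matrix_vec: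
  "rigidity_matrix E p *v c = stretch E p (\<chi> v k. c $ (v, k))"
proof -
  have "(rigidity_matrix E p *v c) $ (i, j) = stretch E p (\<chi> v k. c $ (v, k)) $ (i, j)" for i j
  proof (cases "(i, j) \<in> E")
    case True
    have entry: "rigidity_matrix E p $ (i, j) $ (v, k) =
        (if v = i then (p $ i - p $ j) $ k else 0) - (if v = j then (p $ i - p $ j) $ k else 0)" for v k
      using True by (auto simp: rigidity_matrix_def)
    have "(rigidity_matrix E p *v c) $ (i, j) =
        (\<Sum>k\<in>UNIV. \<Sum>v\<in>UNIV. rigidity_matrix E p $ (i, j) $ (v, k) * c $ (v, k))"
      unfolding matrix_vector_mult_def
      by (subst sum.swap) (simp add: sum.cartesian_product UNIV_Times_UNIV case_prod_unfold)
    also have "\<dots> = (\<Sum>k\<in>UNIV. (p $ i - p $ j) $ k * c $ (i, k) - (p $ i - p $ j) $ k * c $ (j, k))"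
      unfolding entry by (simp add: left_diff_distrib sum_subtractf if_distrib[of "\<lambda>x. x * _"] cong: if_cong)
    also have "\<dots> = stretch E p (\<chi> v k. c $ (v, k)) $ (i, j)"
      using True by (simp add: stretch_def inner_vec_def right_diff_distrib)
    finally show ?thesis .
  next
    case False
    then show ?thesis by (simp add: matrix_vector_mult_def rigidity_matrix_def stretch_def)
  qed
  then show ?thesis by (simp add: vec_eq_iff)
qed

lemma transpose_directed_rigidity_matrix_vec:
  "(transpose (directed_rigidity_matrix E p) *v y) $ (v, k) =
     (\<Sum>j | (v, j) \<in> E. y $ (v, j) *\<^sub>R (p $ v - p $ j)) $ k"
proof -
  have "(transpose (directed_rigidity_matrix E p) *v y) $ (v, k) =
      (\<Sum>j\<in>UNIV. \<Sum>i\<in>UNIV. directed_rigidity_matrix E p $ (i, j) $ (v, k) * y $ (i, j))"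
    unfolding matrix_vector_mult_def transpose_def
    by (subst sum.swap) (simp add: sum.cartesian_product UNIV_Times_UNIV case_prod_unfold)
  also have "\<dots> = (\<Sum>j\<in>UNIV. \<Sum>i\<in>UNIV. if i = v then
      (if (v, j) \<in> E then (p $ v - p $ j) $ k * y $ (v, j) else 0) else 0)"
    by (intro sum.cong refl) (auto simp: directed_rigidity_matrix_def)
  also have "\<dots> = (\<Sum>j | (v, j) \<in> E. (p $ v - p $ j) $ k * y $ (v, j))"
    by (simp add: sum.If_cases)
  finally show ?thesis by (simp add: mult.commute)
qed

text \<open>
  This replaces an operator on edge vectors by one on configurations, which acts along the arcs and
  therefore becomes triangular when the vertices are ordered.
\<close>

lemma edge_operator_stretch:
  "edge_operator E p *v stretch E p x = 2 *\<^sub>R stretch E p (control_operator E p x)"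
proof -
  have "(\<chi> v k. (transpose (directed_rigidity_matrix E p) *v stretch E p x) $ (v, k)) =
      control_operator E p x"
    unfolding transpose_directed_rigidity_matrix_vec
    by (simp add: control_operator_def stretch_def vec_eq_iff cong: sum.cong_simp)
  then show ?thesis
    unfolding edge_operator_def
    by (simp add: matrix_scaleR_vector_ac scaleR_matrix_vector_assoc[symmetric]
        matrix_vector_mul_assoc[symmetric] rigidity_matrix_vec)
qed

lemma range_rigidity_matrix: "range (\<lambda>c. rigidity_matrix E p *v c) = range (stretch E p)"
proof -
  have "stretch E p x = rigidity_matrix E p *v (\<chi> e. x $ fst e $ snd e)" for x
    by (simp add: rigidity_matrix_vec)
  then have "range (stretch E p) \<subseteq> range (\<lambda>c. rigidity_matrix E p *v c)" by blast
  then show ?thesis by (auto simp: rigidity_matrix_vec)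
qed

lemma linear_inj_on_imp_bij_betw:
  fixes f :: "'a::euclidean_space \<Rightarrow> 'a"
  assumes "linear f" "subspace W" "f ` W \<subseteq> W" "inj_on f W"
  shows "bij_betw f W W"
proof -
  have "dim (f ` W) = dim W"
    by (rule dim_image_eq[OF assms(1)]) (simp add: span_eq_iff[THEN iffD2, OF assms(2)] assms(4))
  then have "f ` W = W"
    using subspace_dim_equal[OF linear_subspace_image[OF assms(1,2)] assms(2,3)] by simp
  then show ?thesis using assms(4) by (simp add: bij_betw_def)
qed

text \<open>
  Since \<open>R\<close> identifies its image with the configurations modulo \<open>ker R\<close>, invertibility of the edge
  operator means that the control operator is injective on that quotient.
\<close>

lemma bij_edge_operator_iff:
  "bij_betw (\<lambda>y. edge_operator E p *v y)
      (range (\<lambda>c. rigidity_matrix E p *v c)) (range (\<lambda>c. rigidity_matrix E p *v c)) \<longleftrightarrow>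
   (\<forall>x. stretch E p (control_operator E p x) = 0 \<longrightarrow> stretch E p x = 0)"
  (is "bij_betw ?Z ?W ?W \<longleftrightarrow> ?inj")
proof
  assume bij: "bij_betw ?Z ?W ?W"
  show ?inj
  proof (intro allI impI)
    fix x assume "stretch E p (control_operator E p x) = 0"
    then have "?Z (stretch E p x) = ?Z 0" by (simp add: edge_operator_stretch)
    moreover have "stretch E p x \<in> ?W" "0 \<in> ?W"
      unfolding range_rigidity_matrix
      using subspace_0[OF linear_subspace_image[OF linear_stretch subspace_UNIV]] by auto
    moreover have "inj_on ?Z ?W" using bij by (rule bij_betw_imp_inj_on)
    ultimately show "stretch E p x = 0" by (meson inj_onD)
  qed
next
  assume inj: ?inj
  show "bij_betw ?Z ?W ?W"
    unfolding range_rigidity_matrix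
  proof (rule linear_inj_on_imp_bij_betw)
    show "linear ?Z" by simp
    show W: "subspace (range (stretch E p))"
      by (rule linear_subspace_image[OF linear_stretch subspace_UNIV])
    show "?Z ` range (stretch E p) \<subseteq> range (stretch E p)"
      by (auto simp: edge_operator_stretch linear_scale[OF linear_stretch, symmetric])
    show "inj_on ?Z (range (stretch E p))"
    proof (rule inj_onI, clarify)
      fix x y assume "?Z (stretch E p x) = ?Z (stretch E p y)"
      then have "stretch E p (control_operator E p (x - y)) = 0"
        by (simp add: edge_operator_stretch linear_diff[OF linear_stretch] linear_diff[OF linear_control_operator])
      then have "stretch E p (x - y) = 0" using inj by blast
      then show "stretch E p x = stretch E p y" by (simp add: linear_diff[OF linear_stretch])
    qed
  qed
qed

section \<open>Rank bounds for acyclic graphs\<close>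

lemma dim_orthogonal_to_directions:
  fixes p :: "('d::finite, 'v::finite) configuration"
  assumes "general_position p" "i \<notin> J"
  shows "dim {u. \<forall>j\<in>J. (p $ i - p $ j) \<bullet> u = 0} \<le> CARD('d) - min CARD('d) (card J)"
proof -
  obtain J' where J': "J' \<subseteq> J" "card J' = min CARD('d) (card J)"
    using obtain_subset_with_card_n[of "min CARD('d) (card J)" J] by auto
  let ?D = "(\<lambda>j. p $ i - p $ j) ` J'"
  have D: "inj_on (\<lambda>j. p $ i - p $ j) J'" "independent ?D"
    using assms(1)[unfolded general_position_def, rule_format, of i J'] assms(2) J' by auto
  then have "dim (span ?D) = min CARD('d) (card J)"
    by (simp add: dim_eq_card_independent card_image J'(2))
  moreover have "dim {u \<in> UNIV. \<forall>x\<in>span ?D. orthogonal x u} + dim (span ?D) = dim (UNIV :: (real ^ 'd) set)"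
    by (rule dim_subspace_orthogonal_to_vectors) auto
  moreover have "{u. \<forall>j\<in>J. (p $ i - p $ j) \<bullet> u = 0} \<subseteq> {u \<in> UNIV. \<forall>x\<in>span ?D. orthogonal x u}"
  proof
    fix u assume "u \<in> {u. \<forall>j\<in>J. (p $ i - p $ j) \<bullet> u = 0}"
    then have uD: "\<forall>y\<in>?D. orthogonal u y"
      using J'(1) by (auto simp: orthogonal_def inner_commute)
    have "orthogonal u x" if "x \<in> span ?D" for x
      by (rule orthogonal_to_span[OF that]) (use uD in blast)
    then show "u \<in> {u \<in> UNIV. \<forall>x\<in>span ?D. orthogonal x u}" by (simp add: orthogonal_commute)
  qed
  then have "dim {u. \<forall>j\<in>J. (p $ i - p $ j) \<bullet> u = 0} \<le> dim {u \<in> UNIV. \<forall>x\<in>span ?D. orthogonal x u}"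
    by (rule dim_subset)
  ultimately show ?thesis by simp
qed

text \<open>
  The diagonal block of the control operator at \<open>i\<close>.
\<close>

definition vertex_block :: "('v::finite \<times> 'v) set \<Rightarrow> ('d::finite, 'v) configuration \<Rightarrow> 'v \<Rightarrow> real ^ 'd \<Rightarrow> real ^ 'd" where
  "vertex_block E p i u = (\<Sum>j | (i, j) \<in> E. ((p $ i - p $ j) \<bullet> u) *\<^sub>R (p $ i - p $ j))"

text \<open>
  If heads come before tails, the control operator is block triangular.
\<close>

lemma control_operator_leading:
  assumes r: "\<And>i j. (i, j) \<in> E \<Longrightarrow> r j < r i"
    and x: "\<And>j. r j < (r i :: nat) \<Longrightarrow> x $ j = 0"
  shows "control_operator E p x $ i = vertex_block E p i (x $ i)"
    and "r j < r i \<Longrightarrow> control_operator E p x $ j = 0"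
proof -
  show "control_operator E p x $ i = vertex_block E p i (x $ i)"
    unfolding control_operator_def vertex_block_def using r x by (auto intro!: sum.cong)
  assume j: "r j < r i"
  have "x $ k = 0" if "(j, k) \<in> E" for k
    using r[OF that] j by (intro x) simp
  then show "control_operator E p x $ j = 0"
    unfolding control_operator_def using x[OF j] by simp
qed

lemma vertex_block_inner:
  "u \<bullet> vertex_block E p i w = (\<Sum>j | (i, j) \<in> E. ((p $ i - p $ j) \<bullet> u) * ((p $ i - p $ j) \<bullet> w))"
  by (simp add: vertex_block_def inner_sum_right inner_commute mult.commute)

lemma vertex_block_square_eq_0:
  assumes "vertex_block E p i (vertex_block E p i u) = 0" "(i, j) \<in> E"
  shows "(p $ i - p $ j) \<bullet> u = 0"
proof -
  have "vertex_block E p i u \<bullet> vertex_block E p i u = u \<bullet> vertex_block E p i (vertex_block E p i u)"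
    unfolding vertex_block_inner by (simp add: mult.commute)
  then have "vertex_block E p i u = 0" using assms(1) by simp
  then have "(\<Sum>j | (i, j) \<in> E. ((p $ i - p $ j) \<bullet> u)\<^sup>2) = 0"
    using vertex_block_inner[of u E p i u] by (simp add: power2_eq_square)
  then show ?thesis using assms(2) by (simp add: sum_nonneg_eq_0_iff)
qed

text \<open>
  In general position, orthogonality to all directions along the arcs from \<open>i\<close> leaves at most
  \<open>d - min d (out_degree E i)\<close> degrees of freedom for the leading entry at \<open>i\<close>. Both kernel bounds
  below come from this.
\<close>

lemma dim_le_if_leading_entries_orthogonal:
  fixes p :: "('d::finite, 'v::finite) configuration" and r :: "'v \<Rightarrow> nat"
  assumes gp: "general_position p" and r: "inj r" "\<And>i j. (i, j) \<in> E \<Longrightarrow> r j < r i"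
    and W: "subspace W"
    and orth: "\<And>x i j. x \<in> W \<Longrightarrow> (\<And>k. r k < r i \<Longrightarrow> x $ k = 0) \<Longrightarrow> (i, j) \<in> E \<Longrightarrow>
      (p $ i - p $ j) \<bullet> x $ i = 0"
  shows "dim W \<le> (\<Sum>i\<in>UNIV. CARD('d) - min CARD('d) (out_degree E i))"
proof -
  have "dim (leading_entries r W i) \<le> CARD('d) - min CARD('d) (out_degree E i)" for i
  proof -
    have "leading_entries r W i \<subseteq> {u. \<forall>j\<in>{j. (i, j) \<in> E}. (p $ i - p $ j) \<bullet> u = 0}"
    proof
      fix u assume "u \<in> leading_entries r W i"
      then obtain x where x: "u = x $ i" "x \<in> W" "\<forall>k. r k < r i \<longrightarrow> x $ k = 0"
        unfolding leading_entries_def by blast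
      have "(p $ i - p $ j) \<bullet> x $ i = 0" if "(i, j) \<in> E" for j
        by (rule orth[OF x(2) _ that]) (use x(3) in blast)
      then show "u \<in> {u. \<forall>j\<in>{j. (i, j) \<in> E}. (p $ i - p $ j) \<bullet> u = 0}"
        using x(1) by simp
    qed
    then have "dim (leading_entries r W i) \<le> dim {u. \<forall>j\<in>{j. (i, j) \<in> E}. (p $ i - p $ j) \<bullet> u = 0}"
      by (rule dim_subset)
    also have "\<dots> \<le> CARD('d) - min CARD('d) (card {j. (i, j) \<in> E})"
      by (rule dim_orthogonal_to_directions[OF gp]) (use r(2) in blast)
    finally show ?thesis by (simp add: out_degree_def)
  qed
  then show ?thesis using dim_le_sum_leading_entries[OF r(1) W] by (meson order_trans sum_mono)
qed

lemma dim_kernel_stretch_le: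
  fixes p :: "('d::finite, 'v::finite) configuration"
  assumes gp: "general_position p" and "acyclic E"
  shows "dim {x. stretch E p x = 0} \<le> (\<Sum>i\<in>UNIV. CARD('d) - min CARD('d) (out_degree E i))"
proof -
  obtain r :: "'v \<Rightarrow> nat" where r: "inj r" "\<And>i j. (i, j) \<in> E \<Longrightarrow> r j < r i"
    using acyclic_finite_ranking[OF assms(2)] by blast
  show ?thesis
  proof (rule dim_le_if_leading_entries_orthogonal[OF gp r])
    show "subspace {x. stretch E p x = 0}" by (rule linear_subspace_kernel[OF linear_stretch])
    fix x i j
    assume x: "x \<in> {x. stretch E p x = 0}" "\<And>k. r k < r i \<Longrightarrow> x $ k = 0" "(i, j) \<in> E"
    then have "(p $ i - p $ j) \<bullet> (x $ i - x $ j) = 0" by (simp add: stretch_eq_0_iff)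
    then show "(p $ i - p $ j) \<bullet> x $ i = 0" using x(2)[OF r(2)[OF x(3)]] by simp
  qed
qed

text \<open>
  The diagonal blocks are positive semidefinite and hence have the same kernel as their squares, so
  the bound for the operator also holds for its square. This stands in for the generalized kernel.
\<close>

lemma dim_kernel_control_operator_square_le:
  fixes p :: "('d::finite, 'v::finite) configuration"
  assumes gp: "general_position p" and "acyclic E"
  shows "dim {x. control_operator E p (control_operator E p x) = 0}
    \<le> (\<Sum>i\<in>UNIV. CARD('d) - min CARD('d) (out_degree E i))"
proof -
  obtain r :: "'v \<Rightarrow> nat" where r: "inj r" "\<And>i j. (i, j) \<in> E \<Longrightarrow> r j < r i"
    using acyclic_finite_ranking[OF assms(2)] by blast
  let ?L = "control_operator E p"
  show ?thesis
  proof (rule dim_le_if_leading_entries_orthogonal[OF gp r])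
    show "subspace {x. ?L (?L x) = 0}"
      using linear_subspace_kernel[OF linear_compose[OF linear_control_operator linear_control_operator, of E p E p]]
      by (simp add: o_def)
    fix x i j
    assume "x \<in> {x. ?L (?L x) = 0}" and below: "\<And>k. r k < r i \<Longrightarrow> x $ k = 0" and ij: "(i, j) \<in> E"
    have Lx_below: "?L x $ k = 0" if "r k < r i" for k
      by (rule control_operator_leading(2)[where r = r, OF r(2) below that])
    have "0 = ?L (?L x) $ i" using \<open>x \<in> {x. ?L (?L x) = 0}\<close> by simp
    also have "\<dots> = vertex_block E p i (?L x $ i)"
      by (rule control_operator_leading(1)[where r = r, OF r(2) Lx_below])
    also have "?L x $ i = vertex_block E p i (x $ i)"
      by (rule control_operator_leading(1)[where r = r, OF r(2) below])
    finally show "(p $ i - p $ j) \<bullet> x $ i = 0"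
      by (intro vertex_block_square_eq_0[OF _ ij]) simp
  qed
qed

text \<open>
  Injectivity modulo \<open>ker R\<close> makes the control operator \<open>L\<close> bijective on its own range, and it then
  is bijective on each step of the flag inside the range. So every leading entry of the range lies
  in the image of a diagonal block, whose rank is at most \<open>min d (out_degree E i)\<close>.
\<close>

lemma dim_range_control_operator_le:
  fixes p :: "('d::finite, 'v::finite) configuration"
  assumes "acyclic E"
    and inj: "\<And>x. stretch E p (control_operator E p x) = 0 \<Longrightarrow> stretch E p x = 0"
  shows "dim (range (control_operator E p)) \<le> (\<Sum>i\<in>UNIV. min CARD('d) (out_degree E i))"
proof -
  obtain r :: "'v \<Rightarrow> nat" where r: "inj r" "\<And>i j. (i, j) \<in> E \<Longrightarrow> r j < r i"
    using acyclic_finite_ranking[OF assms(1)] by blast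
  let ?L = "control_operator E p"
  have subL: "subspace (range ?L)" by (rule linear_subspace_image[OF linear_control_operator subspace_UNIV])
  have "dim (leading_entries r (range ?L) i) \<le> min CARD('d) (out_degree E i)" for i
  proof -
    define W where "W = {x \<in> range ?L. \<forall>j. r j < r i \<longrightarrow> x $ j = 0}"
    have W: "subspace W" using subL by (auto simp: W_def subspace_def)
    have "?L ` W \<subseteq> W"
    proof clarify
      fix x assume "x \<in> W"
      then have x: "x $ k = 0" if "r k < r i" for k using that unfolding W_def by blast
      have "?L x $ j = 0" if "r j < r i" for j
        by (rule control_operator_leading(2)[OF r(2) x that])
      then show "?L x \<in> W" unfolding W_def by blast
    qed
    moreover have "inj_on ?L W"
    proof (rule inj_onI)
      fix x y assume xy: "x \<in> W" "y \<in> W" "?L x = ?L y"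
      then have "x - y \<in> range ?L" using subspace_diff[OF subL, of x y] by (auto simp: W_def)
      then obtain z where z: "x - y = ?L z" by auto
      have "?L (?L z) = ?L x - ?L y"
        unfolding z[symmetric] by (rule linear_diff[OF linear_control_operator])
      then have "stretch E p (?L (?L z)) = 0" using xy(3) by (simp add: linear_0[OF linear_stretch])
      then have "?L z = 0" using inj stretch_imp_control_operator_0 by blast
      then show "x = y" using z by simp
    qed
    \<comment> \<open>An injective endomorphism of a finite-dimensional space is onto; this is what turns a leading
      entry of \<open>W\<close> into a value of the diagonal block.\<close>
    ultimately have "bij_betw ?L W W"
      by (intro linear_inj_on_imp_bij_betw[OF linear_control_operator W])
    then have onto: "?L ` W = W" by (simp add: bij_betw_def)
    let ?D = "(\<lambda>j. p $ i - p $ j) ` {j. (i, j) \<in> E}"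
    have "leading_entries r (range ?L) i \<subseteq> span ?D"
    proof
      fix u assume "u \<in> leading_entries r (range ?L) i"
      then have "u \<in> (\<lambda>x. x $ i) ` W"
        by (simp only: leading_entries_def W_def setcompr_eq_image)
      then have "u \<in> (\<lambda>x. x $ i) ` ?L ` W" by (simp only: onto)
      then obtain y where y: "y \<in> W" "u = ?L y $ i" unfolding image_image by (rule imageE)
      have "y $ j = 0" if "r j < r i" for j using y(1) that unfolding W_def by blast
      then have "?L y $ i = vertex_block E p i (y $ i)"
        by (intro control_operator_leading(1)[where r = r, OF r(2)])
      moreover have "vertex_block E p i (y $ i) \<in> span ?D"
        unfolding vertex_block_def by (intro span_sum span_scale span_base imageI)
      ultimately show "u \<in> span ?D" using y(2) by simp
    qed
    then have "dim (leading_entries r (range ?L) i) \<le> dim (span ?D)" by (rule dim_subset)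
    also have "\<dots> = dim ?D" by (rule dim_span)
    also have "\<dots> \<le> card ?D" by (rule dim_le_card') simp
    also have "\<dots> \<le> out_degree E i" unfolding out_degree_def by (rule card_image_le) simp
    finally show ?thesis using dim_subset_UNIV[of "leading_entries r (range ?L) i"] by simp
  qed
  then show ?thesis using dim_le_sum_leading_entries[OF r(1) subL] by (meson order_trans sum_mono)
qed

lemma sum_out_degree_complement:
  fixes E :: "('v::finite \<times> 'v) set"
  shows "(\<Sum>i\<in>UNIV. CARD('d) - min CARD('d) (out_degree E i)) + (\<Sum>i\<in>UNIV. min CARD('d) (out_degree E i))
    = DIM(real ^ 'd::finite ^ 'v)"
  by (simp flip: sum.distrib)

lemma card_eq_sum_out_degree: "card E = (\<Sum>i\<in>UNIV. out_degree E i)"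
proof -
  have "(SIGMA i:UNIV. {j. (i, j) \<in> E}) = E" by auto
  then have "card E = card (SIGMA i:UNIV. {j. (i, j) \<in> E})" by (rule arg_cong[OF sym])
  also have "\<dots> = (\<Sum>i\<in>UNIV. out_degree E i)" by (subst card_SigmaI) (auto simp: out_degree_def)
  finally show ?thesis .
qed

lemma dim_supported_on: "dim {y :: real ^ 'n. \<forall>e. e \<notin> A \<longrightarrow> y $ e = 0} = card A"
  using dim_substandard_cart[of A, where ?'a = real] by (simp add: dim_vec_eq)

lemma range_stretch_supported: "range (stretch E p) \<subseteq> {y. \<forall>e. e \<notin> E \<longrightarrow> y $ e = 0}"
  by (auto simp: stretch_def)

text \<open>
  Out-degrees at most \<open>d\<close> make the rows independent, so the distance map is a submersion at every
  configuration in general position.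
\<close>

lemma range_stretch_eq:
  fixes p :: "('d::finite, 'v::finite) configuration"
  assumes "general_position p" "acyclic E" "\<And>i. out_degree E i \<le> CARD('d)"
  shows "range (stretch E p) = {y. \<forall>e. e \<notin> E \<longrightarrow> y $ e = 0}"
proof (rule subspace_dim_equal)
  show "subspace (range (stretch E p))" by (rule linear_subspace_image[OF linear_stretch subspace_UNIV])
  show "subspace {y :: real ^ ('v \<times> 'v). \<forall>e. e \<notin> E \<longrightarrow> y $ e = 0}" by (auto simp: subspace_def)
  show "range (stretch E p) \<subseteq> {y. \<forall>e. e \<notin> E \<longrightarrow> y $ e = 0}" by (rule range_stretch_supported)
  have "DIM(real ^ 'd ^ 'v) \<le> dim (range (stretch E p)) + dim {x. stretch E p x = 0}"
    using dim_le_image_plus_kernel[OF linear_stretch subspace_UNIV, of E p] by simp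
  moreover have "card E = (\<Sum>i\<in>UNIV. min CARD('d) (out_degree E i))"
    unfolding card_eq_sum_out_degree using assms(3) by (simp add: min_absorb2)
  ultimately show "dim {y :: real ^ ('v \<times> 'v). \<forall>e. e \<notin> E \<longrightarrow> y $ e = 0} \<le> dim (range (stretch E p))"
    unfolding dim_supported_on
    using dim_kernel_stretch_le[OF assms(1,2)] sum_out_degree_complement[of E, where ?'d = 'd]
    by linarith
qed

lemma stretch_mono: "E' \<subseteq> E \<Longrightarrow> stretch E p x = 0 \<Longrightarrow> stretch E' p x = 0"
  by (auto simp: stretch_eq_0_iff)

text \<open>
  Injectivity modulo \<open>ker R\<close> gives \<open>ker L = ker R\<close>, so the bound on the rank of \<open>L\<close> bounds the
  dimension of \<open>ker R\<close> from below. It meets the upper bound for the kernel of \<open>E'\<close>, which contains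
  \<open>ker R\<close>.
\<close>

lemma kernel_stretch_eq_if_bij:
  fixes p :: "('d::finite, 'v::finite) configuration"
  assumes gp: "general_position p" and "acyclic E" and sub: "E' \<subseteq> E"
    and deg: "\<And>i. min CARD('d) (out_degree E' i) = min CARD('d) (out_degree E i)"
    and inj: "\<And>x. stretch E p (control_operator E p x) = 0 \<Longrightarrow> stretch E p x = 0"
    and x: "stretch E' p x = 0"
  shows "stretch E p x = 0"
proof -
  have ac: "acyclic E'" using assms(2) sub by (rule acyclic_subset)
  let ?L = "control_operator E p"
  have "{x. ?L x = 0} \<subseteq> {x. stretch E p x = 0}"
    using inj linear_0[OF linear_stretch] by (metis (mono_tags, lifting) Collect_mono)
  then have "dim {x. ?L x = 0} \<le> dim {x. stretch E p x = 0}" by (rule dim_subset)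
  moreover have "DIM(real ^ 'd ^ 'v) \<le> dim (range ?L) + dim {x. ?L x = 0}"
    using dim_le_image_plus_kernel[OF linear_control_operator subspace_UNIV, of E p] by simp
  moreover have "dim {x. stretch E' p x = 0} \<le> (\<Sum>i\<in>UNIV. CARD('d) - min CARD('d) (out_degree E i))"
    using dim_kernel_stretch_le[OF gp ac] by (simp add: deg)
  ultimately have "dim {x. stretch E' p x = 0} \<le> dim {x. stretch E p x = 0}"
    using dim_range_control_operator_le[OF assms(2) inj] sum_out_degree_complement[of E, where ?'d = 'd]
    by linarith
  then have "{x. stretch E p x = 0} = {x. stretch E' p x = 0}"
    using stretch_mono[OF sub]
    by (intro subspace_dim_equal linear_subspace_kernel[OF linear_stretch]) auto
  then show ?thesis using x by blast
qed

text \<open>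
  The kernel for \<open>E'\<close> has dimension at least the number of columns minus the number of arcs of \<open>E'\<close>,
  which is the upper bound for the dimension of the kernel of the square of \<open>L\<close>. The inclusion
  \<open>ker R \<subseteq> ker (L \<circ> L)\<close> is therefore an equality, and \<open>L x \<in> ker R \<subseteq> ker L\<close> puts \<open>x\<close> into \<open>ker R\<close>.
\<close>

lemma bij_if_kernel_stretch_eq:
  fixes p :: "('d::finite, 'v::finite) configuration"
  assumes gp: "general_position p" and "acyclic E"
    and deg: "\<And>i. out_degree E' i = min CARD('d) (out_degree E i)"
    and ker: "\<And>x. stretch E' p x = 0 \<Longrightarrow> stretch E p x = 0"
    and x: "stretch E p (control_operator E p x) = 0"
  shows "stretch E p x = 0"
proof -
  let ?L = "control_operator E p"
  have L2: "subspace {x. ?L (?L x) = 0}"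
    using linear_subspace_kernel[OF linear_compose[OF linear_control_operator linear_control_operator, of E p E p]]
    by (simp add: o_def)
  have "DIM(real ^ 'd ^ 'v) \<le> dim (range (stretch E' p)) + dim {x. stretch E' p x = 0}"
    using dim_le_image_plus_kernel[OF linear_stretch subspace_UNIV, of E' p] by simp
  moreover have "dim (range (stretch E' p)) \<le> (\<Sum>i\<in>UNIV. min CARD('d) (out_degree E i))"
    using dim_subset[OF range_stretch_supported, of E' p]
    unfolding dim_supported_on card_eq_sum_out_degree deg .
  moreover have "dim {x. stretch E' p x = 0} \<le> dim {x. stretch E p x = 0}"
    using ker by (intro dim_subset) auto
  ultimately have "dim {x. ?L (?L x) = 0} \<le> dim {x. stretch E p x = 0}"
    using dim_kernel_control_operator_square_le[OF gp assms(2)]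
      sum_out_degree_complement[of E, where ?'d = 'd] by linarith
  moreover have "{x. stretch E p x = 0} \<subseteq> {x. ?L (?L x) = 0}"
    using stretch_imp_control_operator_0[of E p] linear_0[OF linear_control_operator, of E p] by auto
  ultimately have "{x. stretch E p x = 0} = {x. ?L (?L x) = 0}"
    by (intro subspace_dim_equal L2 linear_subspace_kernel[OF linear_stretch]) auto
  moreover have "?L (?L x) = 0" by (rule stretch_imp_control_operator_0[OF x])
  ultimately show ?thesis by blast
qed

section \<open>Deleting arcs\<close>

lemma deletion_step_min_out_degree:
  assumes "deletion_step d E E'"
  shows "min d (out_degree E' i) = min d (out_degree E i)"
proof -
  obtain a b where ab: "(a, b) \<in> E" "out_degree E a > d" "E' = E - {(a, b)}"
    using assms unfolding deletion_step_def by blast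
  have "{j. (i, j) \<in> E'} = (if i = a then {j. (i, j) \<in> E} - {b} else {j. (i, j) \<in> E})"
    using ab(3) by auto
  then have "out_degree E' i = (if i = a then out_degree E i - 1 else out_degree E i)"
    using ab(1) by (simp add: out_degree_def)
  then show ?thesis using ab(2) by auto
qed

lemma deletion_steps_min_out_degree:
  assumes "(deletion_step d)\<^sup>*\<^sup>* E E'"
  shows "E' \<subseteq> E" and "min d (out_degree E' i) = min d (out_degree E i)"
proof -
  show "E' \<subseteq> E" using assms by induction (auto simp: deletion_step_def)
  show "min d (out_degree E' i) = min d (out_degree E i)"
    using assms by induction (auto simp: deletion_step_min_out_degree)
qed

lemma deletion_steps_terminate:
  "\<exists>E'. (deletion_step d)\<^sup>*\<^sup>* E E' \<and> (\<forall>i. out_degree E' i \<le> d)"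
proof (induction "card E" arbitrary: E rule: less_induct)
  case less
  show ?case
  proof (cases "\<forall>i. out_degree E i \<le> d")
    case False
    then obtain i where i: "out_degree E i > d" by (auto simp: not_le)
    then obtain j where j: "(i, j) \<in> E" unfolding out_degree_def by (metis card.empty empty_Collect_eq not_less_zero)
    have "deletion_step d E (E - {(i, j)})" unfolding deletion_step_def using i j by blast
    moreover have "card (E - {(i, j)}) < card E" using j by (intro psubset_card_mono) auto
    ultimately show ?thesis using less by (meson converse_rtranclp_into_rtranclp)
  qed blast
qed

section \<open>Admissibility and persistence\<close>

lemma rigid_iff_oriented:
  "rigid TYPE('d::finite) (underlying_graph E) \<longleftrightarrow>
     for_every_generic (\<lambda>p :: ('d, 'v::finite) configuration.
       \<forall>\<^sub>F q in nhds p. distance_map E q = distance_map E p \<longrightarrow> congruent_config p q)"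
  unfolding rigid_def distance_map_underlying_graph_eq_iff ..

lemma distance_map_subset:
  "E' \<subseteq> E \<Longrightarrow> distance_map E q = distance_map E p \<Longrightarrow> distance_map E' q = distance_map E' p"
  unfolding distance_map_eq_iff by blast

lemma distance_map_congruent: "congruent_config p q \<Longrightarrow> distance_map E q = distance_map E p"
  unfolding distance_map_eq_iff congruent_config_def by blast

lemma distance_map_diff_in_range:
  fixes p :: "('d::finite, 'v::finite) configuration"
  assumes "general_position p" "acyclic E" "\<And>i. out_degree E i \<le> CARD('d)"
  shows "distance_map E q - distance_map E p \<in> range (\<lambda>v. 2 *\<^sub>R stretch E p v)"
proof -
  have "(1/2) *\<^sub>R (distance_map E q - distance_map E p) \<in> range (stretch E p)"
    unfolding range_stretch_eq[OF assms] by (auto simp: distance_map_def)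
  then obtain v where "stretch E p v = (1/2) *\<^sub>R (distance_map E q - distance_map E p)" by (metis imageE)
  then have "2 *\<^sub>R stretch E p v = distance_map E q - distance_map E p" by simp
  then show ?thesis by (metis rangeI)
qed

theorem mainTheorem13:
  fixes E :: "('v::finite \<times> 'v) set"
  assumes "directed_graph E" and "acyclic E"
  shows "admissible TYPE('d::finite) E \<longleftrightarrow> persistent TYPE('d) E"
proof
  assume adm: "admissible TYPE('d) E"
  let ?inj = "\<lambda>p :: ('d, 'v) configuration.
    \<forall>x. stretch E p (control_operator E p x) = 0 \<longrightarrow> stretch E p x = 0"
  have "for_every_generic ?inj"
    using adm unfolding admissible_def bij_edge_operator_iff by blast
  then have near: "for_every_generic (\<lambda>p :: ('d, 'v) configuration.
      \<forall>\<^sub>F q in nhds p. general_position q \<and> ?inj q)"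
    by (rule for_every_generic_eventually[OF for_every_generic_conj[OF generic_general_position]])
  have rig: "for_every_generic (\<lambda>p :: ('d, 'v) configuration.
      \<forall>\<^sub>F q in nhds p. distance_map E q = distance_map E p \<longrightarrow> congruent_config p q)"
    using adm unfolding admissible_def rigid_iff_oriented by blast
  show "persistent TYPE('d) E"
    unfolding persistent_def rigid_iff_oriented
  proof (intro allI impI)
    fix E' assume E': "(deletion_step CARD('d))\<^sup>*\<^sup>* E E' \<and> (\<forall>i. out_degree E' i \<le> CARD('d))"
    have sub: "E' \<subseteq> E"
      using E' by (rule deletion_steps_min_out_degree(1)[OF conjunct1])
    have deg: "min CARD('d) (out_degree E' i) = min CARD('d) (out_degree E i)" for i
      using E' by (rule deletion_steps_min_out_degree(2)[OF conjunct1])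
    have ac: "acyclic E'" using assms(2) sub by (rule acyclic_subset)
    show "for_every_generic (\<lambda>p :: ('d, 'v) configuration.
        \<forall>\<^sub>F q in nhds p. distance_map E' q = distance_map E' p \<longrightarrow> congruent_config p q)"
    proof (rule for_every_generic_mono[OF for_every_generic_conj[OF near rig]], elim conjE)
      fix p :: "('d, 'v) configuration"
      assume near: "\<forall>\<^sub>F q in nhds p. general_position q \<and> ?inj q"
        and rig: "\<forall>\<^sub>F q in nhds p. distance_map E q = distance_map E p \<longrightarrow> congruent_config p q"
      have gp: "general_position p" using eventually_nhds_x_imp_x[OF near] by blast
      have rng: "distance_map E' q - distance_map E' p \<in> range (\<lambda>v. 2 *\<^sub>R stretch E' p v)" for q
        by (rule distance_map_diff_in_range[OF gp ac]) (use E' in blast)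
      \<comment> \<open>The kernels are compared in a whole neighbourhood of \<open>p\<close>, because the fibre is followed away
        from \<open>p\<close>; this is where the openness of generic properties enters.\<close>
      have ker: "\<forall>\<^sub>F q in nhds p. \<forall>v. 2 *\<^sub>R stretch E' q v = 0 \<longrightarrow> 2 *\<^sub>R stretch E q v = 0"
        using near
      proof eventually_elim
        case elim: (elim q)
        show ?case using kernel_stretch_eq_if_bij[OF _ assms(2) sub deg, of q] elim by auto
      qed
      have "\<forall>\<^sub>F q in nhds p. distance_map E' q = distance_map E' p \<longrightarrow>
          distance_map E q = distance_map E p"
        by (rule kernel_le_imp_constant_on_fibre[OF has_derivative_distance_map continuous_on_stretch
              rng has_derivative_distance_map ker])
      with rig show "\<forall>\<^sub>F q in nhds p. distance_map E' q = distance_map E' p \<longrightarrow> congruent_config p q"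
        by eventually_elim blast
    qed
  qed
next
  assume pers: "persistent TYPE('d) E"
  obtain E' where E': "(deletion_step CARD('d))\<^sup>*\<^sup>* E E'" "\<And>i. out_degree E' i \<le> CARD('d)"
    using deletion_steps_terminate by blast
  then have sub: "E' \<subseteq> E" and deg: "\<And>i. out_degree E' i = min CARD('d) (out_degree E i)"
    using deletion_steps_min_out_degree(1)[OF E'(1)] deletion_steps_min_out_degree(2)[OF E'(1)]
    by (auto simp: min_absorb2) 
  have ac: "acyclic E'" using assms(2) sub by (rule acyclic_subset)
  have rig: "for_every_generic (\<lambda>p :: ('d, 'v) configuration.
      \<forall>\<^sub>F q in nhds p. distance_map E' q = distance_map E' p \<longrightarrow> congruent_config p q)"
    using pers E' unfolding persistent_def rigid_iff_oriented by blast
  show "admissible TYPE('d) E"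
    unfolding admissible_def rigid_iff_oriented bij_edge_operator_iff
  proof
    show "for_every_generic (\<lambda>p :: ('d, 'v) configuration.
        \<forall>\<^sub>F q in nhds p. distance_map E q = distance_map E p \<longrightarrow> congruent_config p q)"
      using rig by (rule for_every_generic_mono)
        (auto elim!: eventually_mono dest: distance_map_subset[OF sub])
    show "for_every_generic (\<lambda>p :: ('d, 'v) configuration.
        \<forall>x. stretch E p (control_operator E p x) = 0 \<longrightarrow> stretch E p x = 0)"
    proof (rule for_every_generic_mono[OF for_every_generic_conj[OF rig generic_general_position]],
        elim conjE, intro allI impI)
      fix p x :: "('d, 'v) configuration"
      assume rig: "\<forall>\<^sub>F q in nhds p. distance_map E' q = distance_map E' p \<longrightarrow> congruent_config p q"
        and gp: "general_position p" and x: "stretch E p (control_operator E p x) = 0"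
      have const: "\<forall>\<^sub>F q in nhds p. distance_map E' q = distance_map E' p \<longrightarrow>
          distance_map E q = distance_map E p"
        using rig by eventually_elim (use distance_map_congruent in blast)
      have rng: "distance_map E' q - distance_map E' p \<in> range (\<lambda>v. 2 *\<^sub>R stretch E' p v)" for q
        by (rule distance_map_diff_in_range[OF gp ac]) (use E' in blast)
      have "2 *\<^sub>R stretch E p v = 0" if "2 *\<^sub>R stretch E' p v = 0" for v
        by (rule constant_on_fibre_imp_kernel_le[OF has_derivative_distance_map continuous_on_stretch
              rng has_derivative_distance_map const that])
      then show "stretch E p x = 0"
        by (intro bij_if_kernel_stretch_eq[OF gp assms(2) deg _ x]) auto
    qed
  qed
qed

end
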